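(* Let $\alpha, \varepsilon\in\mathbb{R}$ be fixed with $\alpha\neq 1$ and $\varepsilon\geq 0$. Suppose that the function $f:]0,1[\rightarrow\mathbb{R}$ satisfies the inequality \[ \left|f(x)+(1-x)^{\alpha}f\left(\frac{y}{1-x}\right)-f(y)-(1-y)^{\alpha}f\left(\frac{x}{1-y}\right)\right|\leq\varepsilon \] for all $(x,y)\in D^{\circ}$. Then: (1) if $\alpha=0$, there exist a logarithmic function $l:]0,1[\rightarrow\mathbb{R}$ and $c\in\mathbb{R}$ such that \[ \left|f(x)-\left[l(1-x)+c\right]\right|\leq K(\alpha)\varepsilon \quad\text{for all } x\in\,]0,1[; \] (2) if $\alpha\notin\{0,1\}$, there exist $a,b\in\mathbb{R}$ such that \[ \left|f(x)-\left[ax^{\alpha}+b(1-x)^{\alpha}-b\right]\right|\leq K(\alpha)\varepsilon \quad\text{for all } x\in\,]0,1[, \] where \[ K(\alpha)=\begin{cases} \left|2^{1-\alpha}-1\right|^{-1}\left(8+6\cdot 2^{\alpha}+2^{-\alpha}\right), & \text{if } \alpha<0,\\ 63, & \text{if } \alpha=0,\\ \left|2^{1-\alpha}-1\right|^{-1}\left(3+12\cdot 2^{\alpha}+\dfrac{32\cdot 3^{\alpha+1}}{\left|2^{-\alpha}-1\right|}\right), & \text{if } \alpha>0 \ (\alpha\neq 1). \end{cases} \]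
   Context: $]0,1[$ denotes the open unit interval. $D^{\circ}=\{(x,y)\in\mathbb{R}^2 \mid x,\ y,\ x+y\in\,]0,1[\}$. A function $l:]0,1[\rightarrow\mathbb{R}$ is called logarithmic if $l(xy)=l(x)+l(y)$ for all $x,y\in\,]0,1[$ (no regularity is assumed). *)

theory Defs
  imports Complex_Main
begin

text \<open>
  Functions on the open unit interval are modelled as total functions of type
  \<open>real \<Rightarrow> real\<close>; only their values on \<open>{0<..<1}\<close> are ever constrained or used.
\<close>

definition D_open :: "(real \<times> real) set" where
  "D_open = {(x, y). x \<in> {0<..<1} \<and> y \<in> {0<..<1} \<and> x + y \<in> {0<..<1}}"

definition logarithmic :: "(real \<Rightarrow> real) \<Rightarrow> bool" where
  "logarithmic l \<longleftrightarrow> (\<forall>x\<in>{0<..<1}. \<forall>y\<in>{0<..<1}. l (x * y) = l x + l y)"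

text \<open>
  The stability constant. It is meaningful only for \<open>\<alpha> \<noteq> 1\<close>: at \<open>\<alpha> = 1\<close> the last branch
  inverts zero.
\<close>

definition K :: "real \<Rightarrow> real" where
  "K \<alpha> =
    (if \<alpha> < 0 then
       inverse \<bar>2 powr (1 - \<alpha>) - 1\<bar> * (8 + 6 * 2 powr \<alpha> + 2 powr (- \<alpha>))
     else if \<alpha> = 0 then 63
     else
       inverse \<bar>2 powr (1 - \<alpha>) - 1\<bar> *
         (3 + 12 * 2 powr \<alpha> + (32 * 3 powr (\<alpha> + 1)) / \<bar>2 powr (- \<alpha>) - 1\<bar>))"

end

theory Submission
  imports Defs
begin

text \<open>
  Put \<open>F(u, v) = (u + v)\<^sup>\<alpha> f(v / (u + v))\<close>. This function is homogeneous of degree \<open>\<alpha>\<close>, and the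
  hypothesis says that \<open>F(u + v, w) + F(u, v)\<close> is symmetric in \<open>v\<close> and \<open>w\<close> up to
  \<open>\<epsilon>(u + v + w)\<^sup>\<alpha>\<close>. Summing cyclically, \<open>S(u, v) = F(u, v) - F(v, u)\<close> satisfies
  \<open>S(u, v) + S(v, w) + S(w, u) \<approx> 0\<close>, so \<open>k(t) = S(t, 1)\<close> satisfies
  \<open>k(tu) \<approx> k(t) + t\<^sup>\<alpha> k(u)\<close>. If \<open>\<alpha> < 0\<close>, letting \<open>w\<close> tend to infinity makes this exact; if
  \<open>\<alpha> = 0\<close>, Hyers' theorem applies; if \<open>\<alpha> > 0\<close>, exchanging \<open>t\<close> and \<open>u\<close> and putting
  \<open>u = 1/2\<close> determines \<open>k\<close> up to an error. Subtracting an exact solution makes \<open>F\<close> almost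
  symmetric. Expanding \<open>(u + u) + (v + v) = (u + v) + (u + v)\<close> in two ways then bounds
  \<open>2F(u, v) - F(2u, 2v) = (2 - 2\<^sup>\<alpha>) F(u, v)\<close> after the diagonal \<open>F(u, u)\<close> has been removed.
\<close>

section \<open>Almost cocycles that are nearly symmetric\<close>

text \<open>Both conditions survive subtraction of an exact homogeneous solution, so the locale is
  interpreted again for each corrected function \<open>G\<close>, with the same
  \<open>\<epsilon>\<close>.\<close>

locale almost_cocycle =
  fixes \<alpha> \<epsilon> :: real and F :: "real \<Rightarrow> real \<Rightarrow> real"
  assumes homogeneous: "\<lbrakk>t > 0; u > 0; v > 0\<rbrakk> \<Longrightarrow> F (t * u) (t * v) = t powr \<alpha> * F u v"
    and cocycle: "\<lbrakk>u > 0; v > 0; w > 0\<rbrakk> \<Longrightarrow>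
      \<bar>F (u + v) w + F u v - F (u + w) v - F u w\<bar> \<le> \<epsilon> * (u + v + w) powr \<alpha>"
begin

lemma near_coboundary_zero_diagonal:
  assumes sym: "\<And>u v. \<lbrakk>u > 0; v > 0\<rbrakk> \<Longrightarrow> \<bar>F u v - F v u\<bar> \<le> s * (u + v) powr \<alpha>"
    and diag: "F 1 1 = 0"
    and "u > 0" "v > 0"
  shows "\<bar>2 - 2 powr \<alpha>\<bar> * \<bar>F u v\<bar> \<le>
    (\<epsilon> + 2 * s) * (2 * u + v) powr \<alpha> + (2 * \<epsilon> + s) * (2 * (u + v)) powr \<alpha>"
proof -
  have diag': "F t t = 0" if "t > 0" for t
    using homogeneous[of t 1 1] diag that by simp
  have "\<bar>F (u + u) v + F u u - F (u + v) u - F u v\<bar> \<le> \<epsilon> * (u + u + v) powr \<alpha>"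
    by (rule cocycle) (use assms in auto)
  then have 1: "\<bar>F (2 * u) v - F (u + v) u - F u v\<bar> \<le> \<epsilon> * (2 * u + v) powr \<alpha>"
    using diag' assms by simp
  have "\<bar>F (v + 2 * u) v + F v (2 * u) - F (v + v) (2 * u) - F v v\<bar>
      \<le> \<epsilon> * (v + 2 * u + v) powr \<alpha>"
    by (rule cocycle) (use assms in auto)
  then have 2: "\<bar>F (2 * u + v) v + F v (2 * u) - F (2 * v) (2 * u)\<bar>
      \<le> \<epsilon> * (2 * (u + v)) powr \<alpha>"
    using diag' assms by (simp add: algebra_simps)
  have "\<bar>F (u + (u + v)) v + F u (u + v) - F (u + v) (u + v) - F u v\<bar>
      \<le> \<epsilon> * (u + (u + v) + v) powr \<alpha>"
    by (rule cocycle) (use assms in auto)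
  then have 3: "\<bar>F (2 * u + v) v + F u (u + v) - F u v\<bar> \<le> \<epsilon> * (2 * (u + v)) powr \<alpha>"
    using diag' assms by (simp add: algebra_simps)
  have 4: "\<bar>F (2 * u) v - F v (2 * u)\<bar> \<le> s * (2 * u + v) powr \<alpha>"
    by (rule sym) (use assms in auto)
  have "\<bar>F (u + v) u - F u (u + v)\<bar> \<le> s * (u + v + u) powr \<alpha>"
    by (rule sym) (use assms in auto)
  then have 5: "\<bar>F (u + v) u - F u (u + v)\<bar> \<le> s * (2 * u + v) powr \<alpha>"
    by (simp add: algebra_simps)
  have "\<bar>F (2 * u) (2 * v) - F (2 * v) (2 * u)\<bar> \<le> s * (2 * u + 2 * v) powr \<alpha>"
    by (rule sym) (use assms in auto)
  then have 6: "\<bar>F (2 * u) (2 * v) - F (2 * v) (2 * u)\<bar> \<le> s * (2 * (u + v)) powr \<alpha>"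
    by (simp add: algebra_simps)
  have "\<bar>2 - 2 powr \<alpha>\<bar> * \<bar>F u v\<bar> = \<bar>2 * F u v - F (2 * u) (2 * v)\<bar>"
    using homogeneous[of 2 u v] assms by (simp add: abs_mult[symmetric] algebra_simps)
  \<comment> \<open>The difference of 2 and 3 puts \<open>F v (2 * u) - F u (u + v)\<close> near
    \<open>F (2 * v) (2 * u) - F u v\<close>. By 4, 5 and then 1, the same quantity is near
    \<open>F u v\<close>. Hence \<open>2 * F u v\<close> is near \<open>F (2 * v) (2 * u)\<close>,
    and 6 exchanges the arguments.\<close>
  also have "\<dots> \<le> (\<epsilon> * (2 * u + v) powr \<alpha> + 2 * (s * (2 * u + v) powr \<alpha>))
      + (2 * (\<epsilon> * (2 * (u + v)) powr \<alpha>) + s * (2 * (u + v)) powr \<alpha>)"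
    using 1 2 3 4 5 6 by linarith
  finally show ?thesis by (simp add: algebra_simps)
qed

text \<open>The coboundary \<open>u powr \<alpha> + v powr \<alpha> - (u + v) powr \<alpha>\<close>
  is a symmetric exact solution. Its value at (1, 1) is \<open>2 - 2 powr \<alpha>\<close>, nonzero
  for \<open>\<alpha> \<noteq> 1\<close>, so a suitable multiple removes the diagonal of
  \<open>F\<close> without changing the antisymmetric part.\<close>

lemma near_coboundary:
  assumes sym: "\<And>u v. \<lbrakk>u > 0; v > 0\<rbrakk> \<Longrightarrow> \<bar>F u v - F v u\<bar> \<le> s * (u + v) powr \<alpha>"
    and "\<alpha> \<noteq> 1"
  obtains b where "\<And>u v. \<lbrakk>u > 0; v > 0\<rbrakk> \<Longrightarrow>
    \<bar>2 - 2 powr \<alpha>\<bar> * \<bar>F u v - b * (u powr \<alpha> + v powr \<alpha> - (u + v) powr \<alpha>)\<bar> \<le>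
    (\<epsilon> + 2 * s) * (2 * u + v) powr \<alpha> + (2 * \<epsilon> + s) * (2 * (u + v)) powr \<alpha>"
proof -
  have "2 powr \<alpha> \<noteq> 2 powr 1"
    using \<open>\<alpha> \<noteq> 1\<close> powr_inj[of 2 \<alpha> 1] by auto
  then have ne: "2 - 2 powr \<alpha> \<noteq> 0" by simp
  define b where "b = F 1 1 / (2 - 2 powr \<alpha>)"
  define G where "G u v = F u v - b * (u powr \<alpha> + v powr \<alpha> - (u + v) powr \<alpha>)" for u v
  interpret G: almost_cocycle \<alpha> \<epsilon> G
  proof
    fix t u v :: real
    assume "t > 0" "u > 0" "v > 0"
    moreover from this have "(t * u + t * v) powr \<alpha> = t powr \<alpha> * (u + v) powr \<alpha>"
      by (simp add: powr_mult flip: distrib_left)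
    ultimately show "G (t * u) (t * v) = t powr \<alpha> * G u v"
      by (simp add: G_def homogeneous powr_mult algebra_simps)
  next
    fix u v w :: real
    assume pos: "u > 0" "v > 0" "w > 0"
    have "G (u + v) w + G u v - G (u + w) v - G u w = F (u + v) w + F u v - F (u + w) v - F u w"
      by (simp add: G_def algebra_simps)
    with cocycle[OF pos]
    show "\<bar>G (u + v) w + G u v - G (u + w) v - G u w\<bar> \<le> \<epsilon> * (u + v + w) powr \<alpha>"
      by simp
  qed
  have "G 1 1 = 0"
    using ne by (simp add: G_def b_def)
  moreover have "\<bar>G u v - G v u\<bar> \<le> s * (u + v) powr \<alpha>" if "u > 0" "v > 0" for u v
    using sym[OF that] by (simp add: G_def add.commute)
  ultimately show ?thesis
    using G.near_coboundary_zero_diagonal that unfolding G_def by blast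
qed

section \<open>The antisymmetric part and its multiplicative equation\<close>

text \<open>In the sum of the three cyclic instances of \<open>cocycle\<close>, every term whose
  first argument is a sum occurs twice with opposite signs. Only the antisymmetric differences
  remain.\<close>

lemma antisymmetric_part_cyclic:
  assumes "u > 0" "v > 0" "w > 0"
  shows "\<bar>(F u v - F v u) + (F v w - F w v) + (F w u - F u w)\<bar> \<le> 3 * \<epsilon> * (u + v + w) powr \<alpha>"
proof -
  have "\<bar>F (v + w) u + F v w - F (v + u) w - F v u\<bar> \<le> \<epsilon> * (v + w + u) powr \<alpha>"
    "\<bar>F (w + u) v + F w u - F (w + v) u - F w v\<bar> \<le> \<epsilon> * (w + u + v) powr \<alpha>"
    using cocycle assms by blast+
  then show ?thesis
    using cocycle[OF assms] by (simp add: add_ac)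
qed

definition k :: "real \<Rightarrow> real" where
  "k t = F t 1 - F 1 t"

lemma antisymmetric_part_eq:
  assumes "u > 0" "v > 0"
  shows "F u v - F v u = v powr \<alpha> * k (u / v)"
  using homogeneous[of v "u / v" 1] homogeneous[of v 1 "u / v"] assms
  by (simp add: k_def right_diff_distrib)

text \<open>For \<open>\<alpha> = 0\<close> this is an approximate logarithmic equation. For other
  exponents it is a twisted version of it, which the functions
  \<open>c * (1 - t powr \<alpha>)\<close> solve exactly.\<close>

lemma k_mult_near:
  assumes "t > 0" "u > 0"
  shows "\<bar>k (t * u) - k t - t powr \<alpha> * k u\<bar> \<le> 3 * \<epsilon> * (t * u + t + 1) powr \<alpha>"
proof -
  have "F (t * u) t - F t (t * u) = t powr \<alpha> * k u"
    using antisymmetric_part_eq[of "t * u" t] assms by simp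
  then show ?thesis
    using antisymmetric_part_cyclic[of "t * u" t 1] assms by (simp add: k_def)
qed

text \<open>The left side does not involve \<open>w\<close>, while for negative
  \<open>\<alpha>\<close> an auxiliary point \<open>w\<close> gives an error bound that vanishes as
  \<open>w\<close> tends to infinity.\<close>

lemma k_mult_exact:
  assumes "\<alpha> < 0" "t > 0" "u > 0"
  shows "k (t * u) = k t + t powr \<alpha> * k u"
proof -
  have eq: "F (t * u) t - F t (t * u) = t powr \<alpha> * k u"
    using antisymmetric_part_eq[of "t * u" t] assms by simp
  \<comment> \<open>The three arguments sum to 1, so the power equals 1 and
    \<open>\<epsilon>\<close> itself bounds an absolute value.\<close>
  have "\<epsilon> * 1 \<ge> 0"
    using cocycle[of "1/3" "1/3" "1/3"] by simp
  then have "\<epsilon> \<ge> 0" by simp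
  have bound: "\<bar>k (t * u) - k t - t powr \<alpha> * k u\<bar> \<le> 9 * \<epsilon> * w powr \<alpha>" if "w > 0" for w
  proof -
    have le: "3 * \<epsilon> * (x + y + w) powr \<alpha> \<le> 3 * \<epsilon> * w powr \<alpha>" if "x > 0" "y > 0" for x y
      using that \<open>w > 0\<close> \<open>\<alpha> < 0\<close> \<open>\<epsilon> \<ge> 0\<close>
      by (intro mult_left_mono powr_mono2') auto
    \<comment> \<open>These are the cyclic relations for (tu, t, w), (t, 1, w) and (1, tu, w). In
      their sum all differences involving \<open>w\<close> cancel.\<close>
    have
      "\<bar>(F (t * u) t - F t (t * u)) + (F t w - F w t) + (F w (t * u) - F (t * u) w)\<bar> \<le> 3 * \<epsilon> * w powr \<alpha>"
      "\<bar>(F t 1 - F 1 t) + (F 1 w - F w 1) + (F w t - F t w)\<bar> \<le> 3 * \<epsilon> * w powr \<alpha>"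
      "\<bar>(F 1 (t * u) - F (t * u) 1) + (F (t * u) w - F w (t * u)) + (F w 1 - F 1 w)\<bar> \<le> 3 * \<epsilon> * w powr \<alpha>"
      using that assms
      by (meson antisymmetric_part_cyclic le order_trans mult_pos_pos zero_less_one)+
    then show ?thesis
      unfolding k_def eq[symmetric, unfolded k_def] by linarith
  qed
  have "((\<lambda>w. 9 * \<epsilon> * w powr \<alpha>) \<longlongrightarrow> 9 * \<epsilon> * 0) at_top"
    by (intro tendsto_intros tendsto_neg_powr \<open>\<alpha> < 0\<close> filterlim_ident)
  then have "\<bar>k (t * u) - k t - t powr \<alpha> * k u\<bar> \<le> 9 * \<epsilon> * 0"
    by (rule tendsto_lowerbound)
      (auto intro: bound eventually_mono[OF eventually_gt_at_top[of 0]])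
  then show ?thesis by simp
qed

section \<open>Approximation for nonzero exponents\<close>

lemma near_solution_nonzero:
  assumes "\<alpha> \<noteq> 1"
    and k: "\<And>t. t > 0 \<Longrightarrow> \<bar>k t - c * (1 - t powr \<alpha>)\<bar> \<le> s * (t + 1) powr \<alpha>"
  obtains a b where "\<And>x. x \<in> {0<..<1} \<Longrightarrow>
    \<bar>2 - 2 powr \<alpha>\<bar> * \<bar>F (1 - x) x - (a * x powr \<alpha> + b * (1 - x) powr \<alpha> - b)\<bar> \<le>
    (\<epsilon> + 2 * s) * (2 - x) powr \<alpha> + (2 * \<epsilon> + s) * 2 powr \<alpha>"
proof -
  \<comment> \<open>The function \<open>c * v powr \<alpha>\<close> is an exact solution, and its
    own \<open>k\<close> is \<open>c * (1 - t powr \<alpha>)\<close>. Subtracting it leaves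
    \<open>G\<close> nearly symmetric.\<close>
  define G where "G u v = F u v - c * v powr \<alpha>" for u v
  interpret G: almost_cocycle \<alpha> \<epsilon> G
  proof
    fix t u v :: real
    assume "t > 0" "u > 0" "v > 0"
    then show "G (t * u) (t * v) = t powr \<alpha> * G u v"
      by (simp add: G_def homogeneous powr_mult algebra_simps)
  next
    fix u v w :: real
    assume "u > 0" "v > 0" "w > 0"
    then show "\<bar>G (u + v) w + G u v - G (u + w) v - G u w\<bar> \<le> \<epsilon> * (u + v + w) powr \<alpha>"
      using cocycle[of u v w] by (simp add: G_def)
  qed
  have "\<bar>G u v - G v u\<bar> \<le> s * (u + v) powr \<alpha>" if "u > 0" "v > 0" for u v
  proof -
    have "G u v - G v u = v powr \<alpha> * (k (u / v) - c * (1 - (u / v) powr \<alpha>))"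
      using antisymmetric_part_eq[of u v] that
      by (simp add: G_def powr_divide algebra_simps)
    then have "\<bar>G u v - G v u\<bar> \<le> v powr \<alpha> * (s * (u / v + 1) powr \<alpha>)"
      using k[of "u / v"] that by (simp add: abs_mult mult_left_mono)
    also have "\<dots> = s * (v * (u / v + 1)) powr \<alpha>"
      using that by (subst powr_mult) auto
    also have "v * (u / v + 1) = u + v"
      using that by (simp add: field_simps)
    finally show ?thesis .
  qed
  from G.near_coboundary[OF this \<open>\<alpha> \<noteq> 1\<close>] obtain b where b: "\<And>u v. \<lbrakk>u > 0; v > 0\<rbrakk> \<Longrightarrow>
    \<bar>2 - 2 powr \<alpha>\<bar> * \<bar>G u v - b * (u powr \<alpha> + v powr \<alpha> - (u + v) powr \<alpha>)\<bar> \<le>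
    (\<epsilon> + 2 * s) * (2 * u + v) powr \<alpha> + (2 * \<epsilon> + s) * (2 * (u + v)) powr \<alpha>"
    by blast
  show ?thesis
  \<comment> \<open>At u = 1 - x, v = x the coboundary contributes \<open>b\<close> to the
    coefficient of \<open>x powr \<alpha>\<close> and the subtracted solution contributes
    \<open>c\<close>.\<close>
  proof (rule that[of "b + c" b])
    fix x :: real
    assume "x \<in> {0<..<1}"
    moreover have "2 * (1 - x) + x = 2 - x" by simp
    moreover have "G (1 - x) x - b * ((1 - x) powr \<alpha> + x powr \<alpha> - (1 - x + x) powr \<alpha>) =
        F (1 - x) x - ((b + c) * x powr \<alpha> + b * (1 - x) powr \<alpha> - b)"
      by (simp add: G_def algebra_simps)
    ultimately show "\<bar>2 - 2 powr \<alpha>\<bar> *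
        \<bar>F (1 - x) x - ((b + c) * x powr \<alpha> + b * (1 - x) powr \<alpha> - b)\<bar> \<le>
        (\<epsilon> + 2 * s) * (2 - x) powr \<alpha> + (2 * \<epsilon> + s) * 2 powr \<alpha>"
      using b[of "1 - x" x] by simp
  qed
qed

lemma near_solution_negative:
  assumes "\<alpha> < 0" "\<epsilon> \<ge> 0"
  obtains a b where "\<And>x. x \<in> {0<..<1} \<Longrightarrow>
    \<bar>2 - 2 powr \<alpha>\<bar> * \<bar>F (1 - x) x - (a * x powr \<alpha> + b * (1 - x) powr \<alpha> - b)\<bar> \<le>
    (1 + 2 * 2 powr \<alpha>) * \<epsilon>"
proof -
  define c where "c = k 2 / (1 - 2 powr \<alpha>)"
  have "2 powr \<alpha> < 1"
    using assms by (simp add: powr_less_one)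
  have "k t = c * (1 - t powr \<alpha>)" if "t > 0" for t
  proof -
    \<comment> \<open>Expanding \<open>k\<close> at 2t in both orders gives a linear equation for
      \<open>k t\<close> with coefficient \<open>1 - 2 powr \<alpha>\<close>.\<close>
    have "k t + t powr \<alpha> * k 2 = k 2 + 2 powr \<alpha> * k t"
      using k_mult_exact[of t 2] k_mult_exact[of 2 t] assms that by (simp add: mult.commute)
    then show ?thesis
      using \<open>2 powr \<alpha> < 1\<close> \<open>\<alpha> < 0\<close> by (simp add: c_def eq_divide_eq) (simp add: algebra_simps)
  qed
  then have "\<bar>k t - c * (1 - t powr \<alpha>)\<bar> \<le> 0 * (t + 1) powr \<alpha>" if "t > 0" for t
    using that by simp
  with near_solution_nonzero[of c 0] assms obtain a b where ab: "\<And>x. x \<in> {0<..<1} \<Longrightarrow>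
    \<bar>2 - 2 powr \<alpha>\<bar> * \<bar>F (1 - x) x - (a * x powr \<alpha> + b * (1 - x) powr \<alpha> - b)\<bar> \<le>
    \<epsilon> * (2 - x) powr \<alpha> + 2 * \<epsilon> * 2 powr \<alpha>"
    by auto
  show ?thesis
  proof (rule that[of a b])
    fix x :: real
    assume x: "x \<in> {0<..<1}"
    have "(2 - x) powr \<alpha> \<le> 1 powr \<alpha>"
      by (rule powr_mono2') (use x assms in auto)
    then have "\<epsilon> * (2 - x) powr \<alpha> \<le> \<epsilon> * 1"
      using assms by (intro mult_left_mono) auto
    with ab[OF x] show "\<bar>2 - 2 powr \<alpha>\<bar> *
        \<bar>F (1 - x) x - (a * x powr \<alpha> + b * (1 - x) powr \<alpha> - b)\<bar> \<le> (1 + 2 * 2 powr \<alpha>) * \<epsilon>"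
      by (simp add: algebra_simps)
  qed
qed

text \<open>Exchanging \<open>t\<close> and 1/2 in \<open>k_mult_near\<close> gives, up to an error,
  a linear equation for \<open>k t\<close> with positive coefficient \<open>d\<close>.\<close>

lemma near_solution_positive:
  assumes "\<alpha> > 0" "\<alpha> \<noteq> 1" "\<epsilon> \<ge> 0"
  obtains a b where "\<And>x. x \<in> {0<..<1} \<Longrightarrow>
    \<bar>2 - 2 powr \<alpha>\<bar> * \<bar>F (1 - x) x - (a * x powr \<alpha> + b * (1 - x) powr \<alpha> - b)\<bar> \<le>
    (3 * 2 powr \<alpha> + 18 * 3 powr \<alpha> / (1 - 2 powr - \<alpha>)) * \<epsilon>"
proof -
  define d where "d = 1 - 2 powr - \<alpha>"
  \<comment> \<open>Both uses of \<open>k_mult_near\<close> have power bases, 3t/2 + 1 and t/2 +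
    3/2, at most 3/2 * (t + 1). Two errors with factor 3 give 6, and division by \<open>d\<close>
    isolates \<open>k t\<close>.\<close>
  define s where "s = 6 * \<epsilon> * (3/2) powr \<alpha> / d"
  define c where "c = k (1/2) / d"
  have half: "(1/2) powr \<alpha> = 1 - d"
    by (simp add: d_def powr_divide powr_minus_divide)
  have "d > 0"
    using assms by (simp add: d_def powr_less_one)
  have "s \<ge> 0"
    using \<open>d > 0\<close> assms by (simp add: s_def)
  have "\<bar>k t - c * (1 - t powr \<alpha>)\<bar> \<le> s * (t + 1) powr \<alpha>" if "t > 0" for t
  proof -
    have le: "3 * \<epsilon> * y powr \<alpha> \<le> 3 * \<epsilon> * (3/2 * (t + 1)) powr \<alpha>"
      if "y > 0" "y \<le> 3/2 * (t + 1)" for y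
      using that assms by (intro mult_left_mono powr_mono2) auto
    have "\<bar>k (t * (1/2)) - k t - t powr \<alpha> * k (1/2)\<bar> \<le> 3 * \<epsilon> * (3/2 * (t + 1)) powr \<alpha>"
      by (rule order_trans[OF k_mult_near le]) (use that in auto)
    moreover have "\<bar>k (1/2 * t) - k (1/2) - (1/2) powr \<alpha> * k t\<bar>
        \<le> 3 * \<epsilon> * (3/2 * (t + 1)) powr \<alpha>"
      by (rule order_trans[OF k_mult_near le]) (use that in auto)
    ultimately have "\<bar>(k t + t powr \<alpha> * k (1/2)) - (k (1/2) + (1 - d) * k t)\<bar>
        \<le> 6 * \<epsilon> * (3/2 * (t + 1)) powr \<alpha>"
      unfolding half by (simp add: mult.commute)
    also have "k (1/2) = d * c"
      using \<open>d > 0\<close> by (simp add: c_def)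
    also have "(k t + t powr \<alpha> * (d * c)) - (d * c + (1 - d) * k t) = d * (k t - c * (1 - t powr \<alpha>))"
      by (simp add: algebra_simps)
    also have "6 * \<epsilon> * (3/2 * (t + 1)) powr \<alpha> = d * (s * (t + 1) powr \<alpha>)"
      using \<open>d > 0\<close> that powr_mult[of "3/2" "t + 1" \<alpha>] by (simp add: s_def)
    finally show ?thesis
      using \<open>d > 0\<close> by (simp add: abs_mult)
  qed
  from near_solution_nonzero[OF \<open>\<alpha> \<noteq> 1\<close> this] obtain a b where ab: "\<And>x. x \<in> {0<..<1} \<Longrightarrow>
    \<bar>2 - 2 powr \<alpha>\<bar> * \<bar>F (1 - x) x - (a * x powr \<alpha> + b * (1 - x) powr \<alpha> - b)\<bar> \<le>
    (\<epsilon> + 2 * s) * (2 - x) powr \<alpha> + (2 * \<epsilon> + s) * 2 powr \<alpha>"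
    by blast
  have prod: "(3/2) powr \<alpha> * 2 powr \<alpha> = 3 powr \<alpha>"
    by (simp flip: powr_mult)
  have "s * 2 powr \<alpha> = 6 * \<epsilon> * ((3/2) powr \<alpha> * 2 powr \<alpha>) / d"
    by (simp add: s_def)
  then have s2: "s * 2 powr \<alpha> = 6 * \<epsilon> * 3 powr \<alpha> / d"
    unfolding prod .
  show ?thesis
  proof (rule that[of a b])
    fix x :: real
    assume x: "x \<in> {0<..<1}"
    have "(2 - x) powr \<alpha> \<le> 2 powr \<alpha>"
      by (rule powr_mono2) (use x assms in auto)
    then have "(\<epsilon> + 2 * s) * (2 - x) powr \<alpha> \<le> (\<epsilon> + 2 * s) * 2 powr \<alpha>"
      using assms \<open>s \<ge> 0\<close> by (intro mult_left_mono) auto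
    with ab[OF x] have "\<bar>2 - 2 powr \<alpha>\<bar> *
        \<bar>F (1 - x) x - (a * x powr \<alpha> + b * (1 - x) powr \<alpha> - b)\<bar> \<le>
        3 * \<epsilon> * 2 powr \<alpha> + 3 * (s * 2 powr \<alpha>)"
      by (simp add: algebra_simps)
    also have "\<dots> = (3 * 2 powr \<alpha> + 18 * 3 powr \<alpha> / (1 - 2 powr - \<alpha>)) * \<epsilon>"
      unfolding s2 by (simp add: d_def algebra_simps)
    finally show "\<bar>2 - 2 powr \<alpha>\<bar> *
        \<bar>F (1 - x) x - (a * x powr \<alpha> + b * (1 - x) powr \<alpha> - b)\<bar> \<le>
        (3 * 2 powr \<alpha> + 18 * 3 powr \<alpha> / (1 - 2 powr - \<alpha>)) * \<epsilon>" .
  qed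
qed

end

section \<open>Hyers' theorem and the exponent zero\<close>

text \<open>Doubling the argument and halving the value changes the approximation
  \<open>g (2 ^ n * x) / 2 ^ n\<close> by at most \<open>\<delta> / 2 ^ Suc n\<close>. These changes
  sum to \<open>\<delta>\<close>.\<close>

lemma Hyers:
  fixes g :: "real \<Rightarrow> real"
  assumes g: "\<And>x y. \<bar>g (x + y) - g x - g y\<bar> \<le> \<delta>"
  obtains A where "\<And>x y. A (x + y) = A x + A y" "\<And>x. \<bar>g x - A x\<bar> \<le> \<delta>"
proof -
  define a where "a x n = g (2 ^ n * x) / 2 ^ n" for x and n :: nat
  have "\<delta> \<ge> 0"
    using g[of 0 0] by linarith
  have step: "\<bar>a x (Suc n) - a x n\<bar> \<le> \<delta> * (1/2) ^ Suc n" for x n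
  proof -
    have "a x (Suc n) - a x n =
        (g (2 ^ n * x + 2 ^ n * x) - g (2 ^ n * x) - g (2 ^ n * x)) / 2 ^ Suc n"
      by (simp add: a_def field_simps)
    also have "\<bar>\<dots>\<bar> \<le> \<delta> / 2 ^ Suc n"
      unfolding abs_divide power_abs abs_numeral
      by (intro divide_right_mono g) simp
    finally show ?thesis by (simp add: power_one_over)
  qed
  have geo: "(\<lambda>n. \<delta> * (1/2) ^ Suc n) sums \<delta>"
    using sums_mult[OF power_half_series, of \<delta>] by simp
  \<comment> \<open>The limit of \<open>a x\<close> is written as a telescoping series, so its
    distance from \<open>g x\<close> is bounded termwise.\<close>
  define A where "A x = g x + (\<Sum>n. a x (Suc n) - a x n)" for x
  have summable_abs: "summable (\<lambda>n. \<bar>a x (Suc n) - a x n\<bar>)" for x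
    by (rule summable_comparison_test'[OF sums_summable[OF geo]]) (use step in auto)
  have lim: "a x \<longlonglongrightarrow> A x" for x
  proof -
    have "summable (\<lambda>n. a x (Suc n) - a x n)"
      using summable_abs by (rule summable_rabs_cancel)
    then have "(\<lambda>n. \<Sum>i<n. a x (Suc i) - a x i) \<longlonglongrightarrow> A x - g x"
      unfolding A_def using summable_LIMSEQ by fastforce
    then have "(\<lambda>n. g x + (a x n - a x 0)) \<longlonglongrightarrow> g x + (A x - g x)"
      unfolding sum_lessThan_telescope by (rule tendsto_add[OF tendsto_const])
    moreover have "a x 0 = g x"
      by (simp add: a_def)
    ultimately show ?thesis by simp
  qed
  show ?thesis
  proof (rule that[of A])
    fix x y
    \<comment> \<open>The additive defect at stage n is a defect of \<open>g\<close> divided by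
      \<open>2 ^ n\<close>, so it vanishes in the limit.\<close>
    have "(\<lambda>n. a (x + y) n - a x n - a y n) \<longlonglongrightarrow> 0"
    proof (rule tendsto_0_le)
      show "(\<lambda>n. (1/2 :: real) ^ n) \<longlonglongrightarrow> 0"
        by (rule LIMSEQ_power_zero) simp
      show "\<forall>\<^sub>F n in sequentially.
          norm (a (x + y) n - a x n - a y n) \<le> norm ((1/2 :: real) ^ n) * \<delta>"
      proof (intro always_eventually allI)
        fix n
        have "a (x + y) n - a x n - a y n =
            (g (2 ^ n * x + 2 ^ n * y) - g (2 ^ n * x) - g (2 ^ n * y)) / 2 ^ n"
          by (simp add: a_def diff_divide_distrib distrib_left)
        also have "\<bar>\<dots>\<bar> \<le> \<delta> / 2 ^ n"
          unfolding abs_divide power_abs abs_numeral by (intro divide_right_mono g) simp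
        finally show "norm (a (x + y) n - a x n - a y n) \<le> norm ((1/2 :: real) ^ n) * \<delta>"
          by (simp add: power_one_over)
      qed
    qed
    moreover have "(\<lambda>n. a (x + y) n - a x n - a y n) \<longlonglongrightarrow> A (x + y) - A x - A y"
      by (intro tendsto_intros lim)
    ultimately have "A (x + y) - A x - A y = 0"
      using LIMSEQ_unique by blast
    then show "A (x + y) = A x + A y" by simp
  next
    fix x
    have "\<bar>\<Sum>n. a x (Suc n) - a x n\<bar> \<le> (\<Sum>n. \<bar>a x (Suc n) - a x n\<bar>)"
      by (rule summable_rabs[OF summable_abs])
    also have "\<dots> \<le> (\<Sum>n. \<delta> * (1/2) ^ Suc n)"
      by (rule suminf_le[OF step summable_abs sums_summable[OF geo]])
    also have "\<dots> = \<delta>"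
      using geo by (rule sums_unique[symmetric])
    finally show "\<bar>g x - A x\<bar> \<le> \<delta>"
      by (simp add: A_def)
  qed
qed

text \<open>The substitution by \<open>exp\<close> turns the multiplicative relation for
  \<open>k\<close> into Cauchy's equation with error \<open>3 * \<epsilon>\<close>, to which
  \<open>Hyers\<close> applies.\<close>

lemma (in almost_cocycle) near_solution_zero:
  assumes "\<alpha> = 0"
  obtains l c where "\<And>x y. \<lbrakk>x > 0; y > 0\<rbrakk> \<Longrightarrow> l (x * y) = l x + l y"
    "\<And>x. x \<in> {0<..<1} \<Longrightarrow> \<bar>F (1 - x) x - (l (1 - x) + c)\<bar> \<le> 12 * \<epsilon>"
proof -
  have "\<bar>k (exp (x + y)) - k (exp x) - k (exp y)\<bar> \<le> 3 * \<epsilon>" for x y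
    using k_mult_near[of "exp x" "exp y"] assms
    by (simp add: exp_add add_pos_pos less_imp_neq[symmetric])
  from Hyers[of "\<lambda>x. k (exp x)", OF this] obtain A where
    A: "\<And>x y. A (x + y) = A x + A y" "\<And>x. \<bar>k (exp x) - A x\<bar> \<le> 3 * \<epsilon>"
    by blast
  define l where "l x = A (ln x)" for x
  have l_mult: "l (x * y) = l x + l y" if "x > 0" "y > 0" for x y
    using that by (simp add: l_def ln_mult A)
  have "l 1 = 0"
    using l_mult[of 1 1] by simp
  \<comment> \<open>The subtracted function is homogeneous of degree 0 and an exact cocycle, because
    \<open>l (u + v)\<close> telescopes. Its antisymmetric part is
    \<open>l u - l v = l (u / v)\<close>, which is near \<open>k (u / v)\<close>.\<close>
  define G where "G u v = F u v - (l u - l (u + v))" for u v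
  interpret G: almost_cocycle \<alpha> \<epsilon> G
  proof
    fix t u v :: real
    assume "t > 0" "u > 0" "v > 0"
    moreover from this have "l (t * u + t * v) = l t + l (u + v)"
      using l_mult[of t "u + v"] by (simp add: distrib_left)
    ultimately show "G (t * u) (t * v) = t powr \<alpha> * G u v"
      using homogeneous[of t u v] assms by (simp add: G_def l_mult)
  next
    fix u v w :: real
    assume "u > 0" "v > 0" "w > 0"
    then show "\<bar>G (u + v) w + G u v - G (u + w) v - G u w\<bar> \<le> \<epsilon> * (u + v + w) powr \<alpha>"
      using cocycle[of u v w] by (simp add: G_def add_ac)
  qed
  have "\<bar>G u v - G v u\<bar> \<le> 3 * \<epsilon> * (u + v) powr \<alpha>" if "u > 0" "v > 0" for u v
  proof -
    have "l u = l (u / v) + l v"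
      using l_mult[of "u / v" v] that by simp
    then have "G u v - G v u = k (u / v) - l (u / v)"
      using antisymmetric_part_eq[of u v] that assms by (simp add: G_def add.commute)
    then show ?thesis
      using A(2)[of "ln (u / v)"] that assms by (simp add: l_def)
  qed
  from G.near_coboundary[OF this] assms obtain b where b: "\<And>u v. \<lbrakk>u > 0; v > 0\<rbrakk> \<Longrightarrow>
    \<bar>2 - 2 powr \<alpha>\<bar> * \<bar>G u v - b * (u powr \<alpha> + v powr \<alpha> - (u + v) powr \<alpha>)\<bar> \<le>
    (\<epsilon> + 2 * (3 * \<epsilon>)) * (2 * u + v) powr \<alpha> + (2 * \<epsilon> + 3 * \<epsilon>) * (2 * (u + v)) powr \<alpha>"
    by auto
  show ?thesis
  proof (rule that[of l b])
    fix x :: real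
    assume x: "x \<in> {0<..<1}"
    \<comment> \<open>At exponent 0 the coboundary and \<open>2 - 2 powr \<alpha>\<close> are both
      1. The error is \<open>7 * \<epsilon> + 5 * \<epsilon>\<close>.\<close>
    have "G (1 - x) x - b = F (1 - x) x - (l (1 - x) + b)"
      by (simp add: G_def \<open>l 1 = 0\<close>)
    then show "\<bar>F (1 - x) x - (l (1 - x) + b)\<bar> \<le> 12 * \<epsilon>"
      using b[of "1 - x" x] x assms by simp
  qed (rule l_mult)
qed

section \<open>From the functional inequality to an almost cocycle\<close>

lemma almost_cocycle_of_information:
  fixes f :: "real \<Rightarrow> real"
  assumes f: "\<And>x y. (x, y) \<in> D_open \<Longrightarrow>
    \<bar>f x + (1 - x) powr \<alpha> * f (y / (1 - x)) - f y - (1 - y) powr \<alpha> * f (x / (1 - y))\<bar> \<le> \<epsilon>"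
  shows "almost_cocycle \<alpha> \<epsilon> (\<lambda>u v. (u + v) powr \<alpha> * f (v / (u + v)))"
proof
  fix t u v :: real
  assume "t > 0" "u > 0" "v > 0"
  moreover have "t * u + t * v = t * (u + v)"
    by (simp add: distrib_left)
  ultimately show "(t * u + t * v) powr \<alpha> * f (t * v / (t * u + t * v)) =
      t powr \<alpha> * ((u + v) powr \<alpha> * f (v / (u + v)))"
    by (simp add: powr_mult)
next
  fix u v w :: real
  assume pos: "u > 0" "v > 0" "w > 0"
  define m where "m = u + v + w"
  have m: "m > 0" "u + v + w = m" "u + w + v = m"
    using pos by (auto simp: m_def)
  \<comment> \<open>Scaling the triple to total 1 gives a point of \<open>D_open\<close>.
    Multiplying its inequality by \<open>m powr \<alpha>\<close> restores the original
    scale.\<close>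
  define x y where "x = w / m" and "y = v / m"
  have xy: "1 - x = (u + v) / m" "1 - y = (u + w) / m"
    using m by (auto simp: x_def y_def m_def field_simps)
  have "x > 0" "y > 0" "1 - x > 0" "1 - y > 0"
    unfolding xy using pos m(1) by (simp_all add: x_def y_def)
  moreover have "x + y < 1"
    using pos m(1) by (simp add: x_def y_def m_def flip: add_divide_distrib)
  ultimately have "(x, y) \<in> D_open"
    by (simp add: D_open_def)
  from f[OF this]
  have "m powr \<alpha> * \<bar>f x + (1 - x) powr \<alpha> * f (y / (1 - x)) - f y - (1 - y) powr \<alpha> * f (x / (1 - y))\<bar>
      \<le> m powr \<alpha> * \<epsilon>"
    by (rule mult_left_mono) simp
  also have "m powr \<alpha> * \<bar>f x + (1 - x) powr \<alpha> * f (y / (1 - x)) - f y - (1 - y) powr \<alpha> * f (x / (1 - y))\<bar>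
      = \<bar>m powr \<alpha> * (f x + (1 - x) powr \<alpha> * f (y / (1 - x)) - f y - (1 - y) powr \<alpha> * f (x / (1 - y)))\<bar>"
    by (simp add: abs_mult)
  also have "m powr \<alpha> * (f x + (1 - x) powr \<alpha> * f (y / (1 - x)) - f y - (1 - y) powr \<alpha> * f (x / (1 - y)))
      = m powr \<alpha> * f x + (m * (1 - x)) powr \<alpha> * f (y / (1 - x))
        - m powr \<alpha> * f y - (m * (1 - y)) powr \<alpha> * f (x / (1 - y))"
    using pos m unfolding xy by (subst (1 2) powr_mult) (simp_all add: algebra_simps)
  also have "m * (1 - x) = u + v"
    using m by (simp add: xy)
  also have "m * (1 - y) = u + w"
    using m by (simp add: xy)
  also have "y / (1 - x) = v / (u + v)"
    using m by (simp add: xy y_def)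
  also have "x / (1 - y) = w / (u + w)"
    using m by (simp add: xy x_def)
  finally show "\<bar>(u + v + w) powr \<alpha> * f (w / (u + v + w)) + (u + v) powr \<alpha> * f (v / (u + v)) -
      (u + w + v) powr \<alpha> * f (v / (u + w + v)) - (u + w) powr \<alpha> * f (w / (u + w))\<bar>
      \<le> \<epsilon> * (u + v + w) powr \<alpha>"
    unfolding m x_def y_def by (simp add: mult.commute)
qed

section \<open>Comparison with the constant \<open>K\<close>\<close>

text \<open>With p = \<open>2 powr \<alpha>\<close>, the inverse in \<open>K\<close> is the absolute
  value of p / (2 - p). The prefactor therefore cancels to p.\<close>

lemma K_negative_ge:
  assumes "\<alpha> < 0"
  shows "1 + 2 * 2 powr \<alpha> \<le> \<bar>2 - 2 powr \<alpha>\<bar> * K \<alpha>"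
proof -
  define p :: real where "p = 2 powr \<alpha>"
  have p: "p > 0" "p < 1"
    using assms by (simp_all add: p_def powr_less_one)
  have "\<bar>2 - p\<bar> * K \<alpha> = \<bar>2 - p\<bar> * (inverse \<bar>2 / p - 1\<bar> * (8 + 6 * p + 1 / p))"
    using assms by (simp add: K_def p_def powr_diff powr_minus_divide)
  also have "2 / p - 1 = (2 - p) / p"
    using p by (simp add: field_simps)
  also have "\<bar>2 - p\<bar> * (inverse \<bar>(2 - p) / p\<bar> * (8 + 6 * p + 1 / p)) = p * (8 + 6 * p + 1 / p)"
    using p by (simp add: abs_div)
  also have "\<dots> = 1 + 8 * p + 6 * p * p"
    using p by (simp add: field_simps)
  also have "\<dots> \<ge> 1 + 2 * p"
    using p by simp
  finally show ?thesis by (simp add: p_def)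
qed

lemma K_positive_ge:
  assumes "\<alpha> > 0" "\<alpha> \<noteq> 1"
  shows "3 * 2 powr \<alpha> + 18 * 3 powr \<alpha> / (1 - 2 powr - \<alpha>) \<le> \<bar>2 - 2 powr \<alpha>\<bar> * K \<alpha>"
proof -
  define p :: real where "p = 2 powr \<alpha>"
  define q :: real where "q = 3 powr \<alpha> / (1 - 2 powr - \<alpha>)"
  have p: "p > 1" "p \<noteq> 2"
    using assms powr_inj[of 2 \<alpha> 1] by (auto simp: p_def gr_one_powr)
  have d: "1 - 2 powr - \<alpha> > 0"
    using p by (simp add: p_def powr_minus inverse_less_1_iff)
  then have "q \<ge> 0"
    by (simp add: q_def)
  \<comment> \<open>The coefficient 96 comes from
    \<open>32 * 3 powr (\<alpha> + 1) = 96 * 3 powr \<alpha>\<close>.\<close>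
  have "\<bar>2 - p\<bar> * K \<alpha> = \<bar>2 - p\<bar> * (inverse \<bar>2 / p - 1\<bar> * (3 + 12 * p + 96 * q))"
    using assms d by (simp add: K_def p_def q_def powr_diff powr_add)
  also have "2 / p - 1 = (2 - p) / p"
    using p by (simp add: field_simps)
  also have "\<bar>2 - p\<bar> * (inverse \<bar>(2 - p) / p\<bar> * (3 + 12 * p + 96 * q)) = p * (3 + 12 * p + 96 * q)"
    using p by (simp add: abs_div)
  finally have "\<bar>2 - p\<bar> * K \<alpha> = 3 * p + 12 * p * p + 96 * (p * q)"
    by (simp add: algebra_simps)
  moreover have "1 * q \<le> p * q"
    using p \<open>q \<ge> 0\<close> by (intro mult_right_mono) auto
  moreover have "0 \<le> 12 * p * p"
    using p by (intro mult_nonneg_nonneg) auto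
  ultimately have "3 * p + 18 * q \<le> \<bar>2 - p\<bar> * K \<alpha>"
    using \<open>q \<ge> 0\<close> by linarith
  then show ?thesis by (simp add: p_def q_def)
qed

theorem theorem3p1:
  fixes \<alpha> \<epsilon> :: real and f :: "real \<Rightarrow> real"
  assumes "\<alpha> \<noteq> 1"
    and "\<epsilon> \<ge> 0"
    and "\<forall>(x, y)\<in>D_open.
      \<bar>f x + (1 - x) powr \<alpha> * f (y / (1 - x)) - f y - (1 - y) powr \<alpha> * f (x / (1 - y))\<bar> \<le> \<epsilon>"
  shows "(\<alpha> = 0 \<longrightarrow>
      (\<exists>l c. logarithmic l \<and> (\<forall>x\<in>{0<..<1}. \<bar>f x - (l (1 - x) + c)\<bar> \<le> K \<alpha> * \<epsilon>))) \<and>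
    (\<alpha> \<notin> {0, 1} \<longrightarrow>
      (\<exists>a b. \<forall>x\<in>{0<..<1}. \<bar>f x - (a * x powr \<alpha> + b * (1 - x) powr \<alpha> - b)\<bar> \<le> K \<alpha> * \<epsilon>))"
proof -
  \<comment> \<open>At the point (1 - x, x) the arguments sum to 1, so this function takes the value
    \<open>f x\<close>.\<close>
  interpret almost_cocycle \<alpha> \<epsilon> "\<lambda>u v. (u + v) powr \<alpha> * f (v / (u + v))"
    using assms by (intro almost_cocycle_of_information) auto
  have pos: "\<bar>2 - 2 powr \<alpha>\<bar> > 0"
    using \<open>\<alpha> \<noteq> 1\<close> powr_inj[of 2 \<alpha> 1] by auto
  have cancel: "z \<le> K \<alpha> * \<epsilon>"
    if "\<bar>2 - 2 powr \<alpha>\<bar> * z \<le> C * \<epsilon>" "C \<le> \<bar>2 - 2 powr \<alpha>\<bar> * K \<alpha>" for z C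
  proof -
    have "C * \<epsilon> \<le> \<bar>2 - 2 powr \<alpha>\<bar> * K \<alpha> * \<epsilon>"
      using that \<open>\<epsilon> \<ge> 0\<close> by (intro mult_right_mono)
    then have "\<bar>2 - 2 powr \<alpha>\<bar> * z \<le> \<bar>2 - 2 powr \<alpha>\<bar> * (K \<alpha> * \<epsilon>)"
      using that(1) by (simp add: mult.assoc)
    then show ?thesis
      using pos by (rule mult_left_le_imp_le)
  qed
  consider "\<alpha> = 0" | "\<alpha> < 0" | "\<alpha> > 0" by linarith
  then show ?thesis
  proof cases
    case 1
    from near_solution_zero[OF 1] obtain l c where
      l: "\<And>x y. \<lbrakk>x > 0; y > 0\<rbrakk> \<Longrightarrow> l (x * y) = l x + l y"
      and c: "\<And>x. x \<in> {0<..<1} \<Longrightarrow>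
        \<bar>(1 - x + x) powr \<alpha> * f (x / (1 - x + x)) - (l (1 - x) + c)\<bar> \<le> 12 * \<epsilon>"
      by blast
    \<comment> \<open>The bound obtained is \<open>12 * \<epsilon>\<close>, below the required
      \<open>63 * \<epsilon>\<close> since \<open>\<epsilon> \<ge> 0\<close>.\<close>
    have "\<bar>f x - (l (1 - x) + c)\<bar> \<le> K \<alpha> * \<epsilon>" if "x \<in> {0<..<1}" for x
      using c[OF that] \<open>\<epsilon> \<ge> 0\<close> that by (simp add: 1 K_def)
    moreover have "logarithmic l"
      using l by (simp add: logarithmic_def)
    ultimately show ?thesis
      using 1 by blast
  next
    case 2
    from near_solution_negative[OF 2 \<open>\<epsilon> \<ge> 0\<close>] obtain a b where
      "\<And>x. x \<in> {0<..<1} \<Longrightarrow> \<bar>2 - 2 powr \<alpha>\<bar> *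
        \<bar>(1 - x + x) powr \<alpha> * f (x / (1 - x + x)) - (a * x powr \<alpha> + b * (1 - x) powr \<alpha> - b)\<bar> \<le>
        (1 + 2 * 2 powr \<alpha>) * \<epsilon>"
      by blast
    then have "\<bar>f x - (a * x powr \<alpha> + b * (1 - x) powr \<alpha> - b)\<bar> \<le> K \<alpha> * \<epsilon>"
      if "x \<in> {0<..<1}" for x
      using cancel[OF _ K_negative_ge[OF 2]] that by simp
    then show ?thesis
      using 2 by blast
  next
    case 3
    from near_solution_positive[OF 3 \<open>\<alpha> \<noteq> 1\<close> \<open>\<epsilon> \<ge> 0\<close>] obtain a b where
      "\<And>x. x \<in> {0<..<1} \<Longrightarrow> \<bar>2 - 2 powr \<alpha>\<bar> *
        \<bar>(1 - x + x) powr \<alpha> * f (x / (1 - x + x)) - (a * x powr \<alpha> + b * (1 - x) powr \<alpha> - b)\<bar> \<le>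
        (3 * 2 powr \<alpha> + 18 * 3 powr \<alpha> / (1 - 2 powr - \<alpha>)) * \<epsilon>"
      by blast
    then have "\<bar>f x - (a * x powr \<alpha> + b * (1 - x) powr \<alpha> - b)\<bar> \<le> K \<alpha> * \<epsilon>"
      if "x \<in> {0<..<1}" for x
      using cancel[OF _ K_positive_ge[OF 3 \<open>\<alpha> \<noteq> 1\<close>]] that by simp
    then show ?thesis
      using 3 by blast
  qed
qed

end
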